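(* For $\bm\gamma_1$, let $\overline h=\sup_{\bm x\in\mathcal X}h(\bm x;\bm\gamma_1)$ and $\underline h=\inf_{\bm x\in\mathcal X}h(\bm x;\bm\gamma_1)$. Suppose that $\underline{\bm x}=\arg\inf_{\bm x}h(\bm x;\bm\gamma_1)$ and $\overline{\bm x}=\arg\sup_{\bm x}h(\bm x;\bm\gamma_1)$ do not depend on $\bm\gamma_1$, and that $h(\bm x;\bm\gamma_1)$ is such that $\overline h/\underline h\to1$ as $\bm\gamma_1\to\bm\gamma_0$. Then $$\lim_{\bm\gamma_1\to\bm\gamma_0}\omega(\bm\gamma_1)=\frac12,\qquad\text{where}\quad \omega(\bm\gamma_1)=\frac{\overline h}{\overline h-\underline h}-\frac1{\log\overline h-\log\underline h}.$$ In particular, for all $\bm\gamma_1$ such that $\overline h/\underline h>1$, $\omega(\bm\gamma_1)>1/2$.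
   Context: Setting. $\mathcal X\subseteq\mathbb{R}^p$ is compact, $h:\mathbb{R}^p\times\mathbb{R}^s\to\mathbb{R}_+$ is a continuous positive function, and $\bm\gamma_0\in\mathbb{R}^s$ is such that $h(\bm x;\bm\gamma_0)=1$ for all $\bm x$. The parameter $\bm\gamma_1$ ranges over a set $\Gamma\subseteq\mathbb{R}^s$ of alternatives having $\bm\gamma_0$ as a limit point (all conditions and limits in $\bm\gamma_1$ are understood within $\Gamma$); "do not depend on $\bm\gamma_1$" means that fixed points $\underline{\bm x},\overline{\bm x}\in\mathcal X$ are respectively a minimizer and a maximizer of $h(\cdot;\bm\gamma_1)$ over $\mathcal X$ for every $\bm\gamma_1\in\Gamma$. The quantity $\omega(\bm\gamma_1)$ is the weight at $\underline{\bm x}$ of the KL-optimal two-point design supported at $\underline{\bm x},\overline{\bm x}$; it is defined when $\overline h/\underline h>1$, and the limit is taken along such $\bm\gamma_1$. *)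

theory Defs
  imports "HOL-Analysis.Analysis"
begin

definition h_upper :: "('a set) \<Rightarrow> ('a \<Rightarrow> 'b \<Rightarrow> real) \<Rightarrow> 'b \<Rightarrow> real" where
  "h_upper X h \<gamma> = (SUP x\<in>X. h x \<gamma>)"

definition h_lower :: "('a set) \<Rightarrow> ('a \<Rightarrow> 'b \<Rightarrow> real) \<Rightarrow> 'b \<Rightarrow> real" where
  "h_lower X h \<gamma> = (INF x\<in>X. h x \<gamma>)"

(* The weight at the minimizer of h in the KL-optimal two-point design supported
   at the minimizer and the maximizer. It is meaningful only where
   h_upper X h \<gamma> / h_lower X h \<gamma> > 1; elsewhere both denominators vanish
   and the value below is an artefact of division by zero. *)
definition kl_weight :: "('a set) \<Rightarrow> ('a \<Rightarrow> 'b \<Rightarrow> real) \<Rightarrow> 'b \<Rightarrow> real" where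
  "kl_weight X h \<gamma> =
     h_upper X h \<gamma> / (h_upper X h \<gamma> - h_lower X h \<gamma>)
     - 1 / (ln (h_upper X h \<gamma>) - ln (h_lower X h \<gamma>))"

end

(* The weight depends only on the ratio r = h_upper / h_lower: it equals
   r / (r - 1) - 1 / ln r, which tends to 1/2 as r tends to 1 from the right, and which exceeds
   1/2 exactly when ln r > 2 (r - 1) / (r + 1). *)
theory Submission
  imports Defs "HOL-Real_Asymp.Real_Asymp"
begin

text \<open>The right-hand side of the derivative test is a square: since
  \<open>(x + 1)\<^sup>2 - 4 * x = (x - 1)\<^sup>2\<close>, the difference of the two sides, which
  is 0 at 1, increases on the right of 1. The rational bound is the [1/1] Pade approximant of
  \<open>ln\<close> at 1.\<close>

lemma ln_gt_pade:
  fixes r :: real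
  assumes "r > 1"
  shows "2 * (r - 1) / (r + 1) < ln r"
proof -
  let ?f = "\<lambda>x::real. ln x - 2 * (x - 1) / (x + 1)"
  have "?f 1 < ?f r"
  \<comment> \<open>The open-interval version is used because the derivative vanishes at the
    endpoint 1.\<close>
  proof (rule DERIV_pos_imp_increasing_open[OF assms])
    fix x :: real
    assume x: "1 < x" "x < r"
    have "(?f has_real_derivative 1 / x - 4 / (x + 1)\<^sup>2) (at x)"
      using x by (auto intro!: derivative_eq_intros simp: power2_eq_square)
    also have "1 / x - 4 / (x + 1)\<^sup>2 = (x - 1)\<^sup>2 / (x * (x + 1)\<^sup>2)"
      using x by (simp add: divide_simps) (simp add: algebra_simps power2_eq_square)
    finally have "(?f has_real_derivative (x - 1)\<^sup>2 / (x * (x + 1)\<^sup>2)) (at x)" .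
    moreover have "(x - 1)\<^sup>2 / (x * (x + 1)\<^sup>2) > 0"
      using x by simp
    ultimately show "\<exists>y. (?f has_real_derivative y) (at x) \<and> y > 0"
      by blast
  next
    show "continuous_on {1..r} ?f"
      by (intro continuous_intros) auto
  qed
  then show ?thesis
    by simp
qed

text \<open>The reciprocal of the Pade bound, \<open>(r + 1) / (2 * (r - 1))\<close>, is exactly
  \<open>r / (r - 1) - 1 / 2\<close>.\<close>

lemma weight_ratio_gt_half:
  fixes r :: real
  assumes "r > 1"
  shows "r / (r - 1) - 1 / ln r > 1 / 2"
proof -
  have "1 / ln r < 1 / (2 * (r - 1) / (r + 1))"
    using ln_gt_pade[OF assms] assms by (intro divide_strict_left_mono) auto
  also have "\<dots> = r / (r - 1) - 1 / 2"
    using assms by (simp add: field_simps)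
  finally show ?thesis
    by linarith
qed

text \<open>With \<open>r = 1 + t\<close>, the terms are \<open>1 / t + 1\<close> and
  \<open>1 / t + 1 / 2 + O(t)\<close>, so the poles cancel.\<close>

lemma weight_ratio_tendsto_half:
  "((\<lambda>r::real. r / (r - 1) - 1 / ln r) \<longlongrightarrow> 1 / 2) (at_right 1)"
  by real_asymp

lemma kl_weight_ratio:
  assumes "h_lower X h \<gamma> > 0" and "h_upper X h \<gamma> / h_lower X h \<gamma> > 1"
  defines "r \<equiv> h_upper X h \<gamma> / h_lower X h \<gamma>"
  shows "kl_weight X h \<gamma> = r / (r - 1) - 1 / ln r"
proof -
  have "h_upper X h \<gamma> > h_lower X h \<gamma>"
    using assms by (simp add: field_simps)
  then show ?thesis
    using assms(1) by (simp add: kl_weight_def r_def ln_div diff_divide_distrib [symmetric] field_simps)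
qed

lemma h_lower_eq_arg_min:
  assumes "is_arg_min (\<lambda>x. h x \<gamma>) (\<lambda>x. x \<in> X) x_min"
  shows "h_lower X h \<gamma> = h x_min \<gamma>"
  unfolding h_lower_def
  using assms by (intro cInf_eq_minimum) (auto simp: is_arg_min_linorder)

theorem theorem6:
  fixes X :: "(real ^ 'p) set"
    and h :: "real ^ 'p \<Rightarrow> real ^ 's \<Rightarrow> real"
    and \<Gamma> :: "(real ^ 's) set"
    and \<gamma>0 :: "real ^ 's"
    and x_min x_max :: "real ^ 'p"
  assumes "compact X"
    and "continuous_on UNIV (\<lambda>(x, \<gamma>). h x \<gamma>)"
    and "\<And>x \<gamma>. h x \<gamma> > 0"
    and "\<And>x. h x \<gamma>0 = 1"
    and "\<gamma>0 islimpt \<Gamma>"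
    and "x_min \<in> X"
    and "x_max \<in> X"
    and "\<And>\<gamma>. \<gamma> \<in> \<Gamma> \<Longrightarrow> is_arg_min (\<lambda>x. h x \<gamma>) (\<lambda>x. x \<in> X) x_min"
    and "\<And>\<gamma>. \<gamma> \<in> \<Gamma> \<Longrightarrow> is_arg_max (\<lambda>x. h x \<gamma>) (\<lambda>x. x \<in> X) x_max"
    and "((\<lambda>\<gamma>. h_upper X h \<gamma> / h_lower X h \<gamma>) \<longlongrightarrow> 1) (at \<gamma>0 within \<Gamma>)"
  shows "(kl_weight X h \<longlongrightarrow> 1 / 2)
           (at \<gamma>0 within {\<gamma> \<in> \<Gamma>. h_upper X h \<gamma> / h_lower X h \<gamma> > 1})
         \<and> (\<forall>\<gamma>\<in>\<Gamma>. h_upper X h \<gamma> / h_lower X h \<gamma> > 1 \<longrightarrow> kl_weight X h \<gamma> > 1 / 2)"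
proof (intro conjI ballI impI)
  let ?r = "\<lambda>\<gamma>. h_upper X h \<gamma> / h_lower X h \<gamma>"
  let ?w = "\<lambda>r::real. r / (r - 1) - 1 / ln r"
  let ?S = "{\<gamma> \<in> \<Gamma>. ?r \<gamma> > 1}"
  have w: "kl_weight X h \<gamma> = ?w (?r \<gamma>)" if "\<gamma> \<in> ?S" for \<gamma>
  proof (rule kl_weight_ratio)
    \<comment> \<open>Pointwise positivity of \<open>h\<close> passes to the infimum because the
      infimum is attained at \<open>x_min\<close>.\<close>
    show "h_lower X h \<gamma> > 0"
      using that assms(3) h_lower_eq_arg_min[of h \<gamma> X x_min, OF assms(8)] by simp
    show "?r \<gamma> > 1"
      using that by blast
  qed
  show "kl_weight X h \<gamma> > 1 / 2" if "\<gamma> \<in> \<Gamma>" "?r \<gamma> > 1" for \<gamma>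
  proof -
    have "\<gamma> \<in> ?S"
      using that by blast
    from w[OF this] weight_ratio_gt_half[OF that(2)] show ?thesis
      by (simp only:)
  qed
  have "(?r \<longlongrightarrow> 1) (at \<gamma>0 within ?S)"
    using assms(10) by (rule tendsto_within_subset) auto
  \<comment> \<open>Membership in \<open>?S\<close> makes the approach to 1 one-sided, as the limit
    of \<open>?w\<close> requires.\<close>
  moreover have "\<forall>\<^sub>F \<gamma> in at \<gamma>0 within ?S. ?r \<gamma> > 1"
    unfolding eventually_at_filter by (intro always_eventually) blast
  ultimately have "filterlim ?r (at_right 1) (at \<gamma>0 within ?S)"
    by (rule tendsto_imp_filterlim_at_right)
  from filterlim_compose[OF weight_ratio_tendsto_half this]
  have "((\<lambda>\<gamma>. ?w (?r \<gamma>)) \<longlongrightarrow> 1 / 2) (at \<gamma>0 within ?S)" .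
  \<comment> \<open>The filter sees only points of \<open>?S\<close>, where \<open>w\<close>
    applies.\<close>
  moreover have "\<forall>\<^sub>F \<gamma> in at \<gamma>0 within ?S. ?w (?r \<gamma>) = kl_weight X h \<gamma>"
    unfolding eventually_at_filter
    by (intro always_eventually allI impI) (rule w [symmetric])
  ultimately show "(kl_weight X h \<longlongrightarrow> 1 / 2) (at \<gamma>0 within ?S)"
    by (rule Lim_transform_eventually)
qed

end
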